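(* Let $\sigma$ be a list of two complex numbers such that $\rho(\sigma)>0$ and $\rho(\sigma)$ occurs in $\sigma$ with multiplicity exactly $1$. Then $\sigma$ is $\mathcal{IR}$ if and only if $\sigma$ is $\mathcal{R}$.
   Context: For a list $\sigma$ of $n$ complex numbers (repeats allowed), $\rho(\sigma)$ denotes the largest absolute value of an element of $\sigma$. The list $\sigma$ is realizable ($\mathcal{R}$) if there is an $n\times n$ entrywise nonnegative matrix whose list of eigenvalues, with multiplicities, is $\sigma$; it is irreducibly realizable ($\mathcal{IR}$) if such a matrix can be chosen irreducible. A square matrix is irreducible if it is not similar by a permutation matrix to a nontrivially block triangular matrix (equivalently, its digraph is strongly connected). *)

theory Defs
  imports "Jordan_Normal_Form.Char_Poly"
begin

definition list_radius :: "complex list \<Rightarrow> real" where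
  "list_radius \<sigma> = Max (cmod ` set \<sigma>)"

definition nonneg_matrix :: "real mat \<Rightarrow> bool" where
  "nonneg_matrix A \<longleftrightarrow> (\<forall>i < dim_row A. \<forall>j < dim_col A. 0 \<le> A $$ (i, j))"

(* Complex eigenvalues of a real matrix with algebraic multiplicity; the order of the list is
   immaterial. *)
definition has_eigenvalue_list :: "real mat \<Rightarrow> complex list \<Rightarrow> bool" where
  "has_eigenvalue_list A \<sigma> \<longleftrightarrow>
     proots (char_poly (map_mat complex_of_real A)) = mset \<sigma>"

definition permutation_matrix :: "nat \<Rightarrow> 'a :: semiring_1 mat \<Rightarrow> bool" where
  "permutation_matrix n P \<longleftrightarrow>
     (\<exists>p. p permutes {..<n} \<and> P = mat n n (\<lambda>(i, j). if i = p j then 1 else 0))"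

(* Upper or lower block triangular, with square diagonal blocks that are both nonempty.
   Two diagonal blocks suffice: with more, merge all blocks after the first. *)
definition block_triangular :: "nat \<Rightarrow> 'a :: zero mat \<Rightarrow> bool" where
  "block_triangular n A \<longleftrightarrow>
     (\<exists>r B C D E. 0 < r \<and> r < n \<and>
        B \<in> carrier_mat r r \<and> C \<in> carrier_mat r (n - r) \<and>
        D \<in> carrier_mat (n - r) r \<and> E \<in> carrier_mat (n - r) (n - r) \<and>
        A = four_block_mat B C D E \<and>
        (C = 0\<^sub>m r (n - r) \<or> D = 0\<^sub>m (n - r) r))"

(* Every 1 x 1 matrix, including the zero matrix, is irreducible under this definition. *)
definition irreducible_matrix :: "nat \<Rightarrow> 'a :: semiring_1 mat \<Rightarrow> bool" where
  "irreducible_matrix n A \<longleftrightarrow>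
     A \<in> carrier_mat n n \<and>
     \<not> (\<exists>B P Q. permutation_matrix n P \<and> similar_mat_wit A B P Q \<and> block_triangular n B)"

definition realizable :: "complex list \<Rightarrow> bool" where
  "realizable \<sigma> \<longleftrightarrow>
     (\<exists>A \<in> carrier_mat (length \<sigma>) (length \<sigma>).
        nonneg_matrix A \<and> has_eigenvalue_list A \<sigma>)"

definition irreducibly_realizable :: "complex list \<Rightarrow> bool" where
  "irreducibly_realizable \<sigma> \<longleftrightarrow>
     (\<exists>A \<in> carrier_mat (length \<sigma>) (length \<sigma>).
        nonneg_matrix A \<and> irreducible_matrix (length \<sigma>) A \<and> has_eigenvalue_list A \<sigma>)"

end

(* If rho, z are the eigenvalues of a nonnegative 2 x 2 matrix with trace t, then z = t - rho is
   real, so z < rho. The matrix with diagonal entries t/2 = (rho + z)/2 and positive off-diagonal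
   entries (rho - z)/2 has the same eigenvalues. *)
theory Submission
  imports Defs
begin

lemma char_poly_mat_2:
  assumes "A \<in> carrier_mat 2 2"
  shows "char_poly A =
    [: A $$ (0, 0) * A $$ (1, 1) - A $$ (0, 1) * A $$ (1, 0), - (A $$ (0, 0) + A $$ (1, 1)), 1 :]"
proof -
  have C: "char_poly_matrix A \<in> carrier_mat 2 2"
    using assms by simp
  \<comment> \<open>Expanding along column 0 leaves 1 x 1 minors; this dimension fact lets
    \<open>det_single\<close> evaluate them.\<close>
  have "mat_delete (char_poly_matrix A) i 0 \<in> carrier_mat 1 1" for i
    using mat_delete_carrier[OF C, of i 0] by simp
  then show ?thesis
    unfolding char_poly_def laplace_expansion_column[OF C, of 0, simplified]
    using assms by (simp add: numeral_2_eq_2 cofactor_def det_single mat_delete_def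
        char_poly_matrix_def algebra_simps)
qed

lemma mset_eq_pair_of_count_list_eq_1:
  assumes "length xs = 2" and "count_list xs a = 1"
  obtains b where "mset xs = {#a, b#}" and "b \<noteq> a"
proof -
  obtain x y where "xs = [x, y]"
    using assms(1) by (auto simp: length_Suc_conv numeral_2_eq_2)
  with assms(2) show thesis
    by (cases "x = a") (auto intro: that[of x] that[of y] simp: add_mset_commute split: if_splits)
qed

text \<open>Over the complex numbers a monic polynomial is the product of its linear factors, so by
  Vieta the root multiset and the coefficients determine each other.\<close>

lemma proots_pair_iff:
  fixes p :: "complex poly"
  assumes "lead_coeff p = 1"
  shows "proots p = {#a, b#} \<longleftrightarrow> p = [: a * b, - (a + b), 1 :]"
proof
  assume "proots p = {#a, b#}"
  with complex_poly_decompose_multiset[of p] assms show "p = [: a * b, - (a + b), 1 :]"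
    by (simp add: algebra_simps)
next
  assume "p = [: a * b, - (a + b), 1 :]"
  then have "p = [:- a, 1:] * [:- b, 1:]"
    by simp
  moreover have "proots [:- c, 1:] = {#c#}" for c :: complex
    by simp
  ultimately show "proots p = {#a, b#}"
    \<comment> \<open>The deleted rules would multiply the linear factors out again before
      \<open>proots_mult\<close> could split the product.\<close>
    by (simp add: proots_mult del: mult_pCons_left mult_pCons_right)
qed

text \<open>Serves both ends of the argument: reading off the trace of a given realization, and
  verifying the constructed one by real arithmetic.\<close>

lemma has_eigenvalue_list_mat_2_iff:
  assumes A: "A \<in> carrier_mat 2 2" and "mset \<sigma> = {#a, b#}"
  shows "has_eigenvalue_list A \<sigma> \<longleftrightarrow>
    a * b = complex_of_real (A $$ (0, 0) * A $$ (1, 1) - A $$ (0, 1) * A $$ (1, 0)) \<and>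
    a + b = complex_of_real (A $$ (0, 0) + A $$ (1, 1))"
proof -
  define B where "B = map_mat complex_of_real A"
  have B: "B \<in> carrier_mat 2 2"
    using A by (simp add: B_def)
  have "has_eigenvalue_list A \<sigma> \<longleftrightarrow> char_poly B = [: a * b, - (a + b), 1 :]"
    unfolding has_eigenvalue_list_def assms(2) B_def[symmetric]
    by (intro proots_pair_iff) (simp add: char_poly_mat_2[OF B])
  also have "\<dots> \<longleftrightarrow> a * b = B $$ (0, 0) * B $$ (1, 1) - B $$ (0, 1) * B $$ (1, 0) \<and>
      a + b = B $$ (0, 0) + B $$ (1, 1)"
    unfolding char_poly_mat_2[OF B] pCons_eq_iff neg_equal_iff_equal by (simp add: eq_commute)
  finally show ?thesis
    using A by (simp add: B_def)
qed

text \<open>The only nontrivial split is 1 + 1, so the off-diagonal blocks are the two off-diagonal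
  entries, one of which would have to vanish.\<close>

lemma not_block_triangular_2:
  assumes "A $$ (0, 1) \<noteq> 0" and "A $$ (1, 0) \<noteq> 0"
  shows "\<not> block_triangular 2 A"
proof
  assume "block_triangular 2 A"
  then obtain r B C D E where r: "0 < r" "r < 2"
    and mats: "B \<in> carrier_mat r r" "C \<in> carrier_mat r (2 - r)"
      "D \<in> carrier_mat (2 - r) r" "E \<in> carrier_mat (2 - r) (2 - r)"
    and AA: "A = four_block_mat B C D E"
    and z: "C = 0\<^sub>m r (2 - r) \<or> D = 0\<^sub>m (2 - r) r"
    unfolding block_triangular_def by blast
  from r have "r = 1" by simp
  with mats AA z assms show False by auto
qed

lemma permutation_matrix_2_cases:
  assumes "permutation_matrix 2 P"
  shows "P = mat 2 2 (\<lambda>(i, j). if i = j then 1 else 0) \<or>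
    P = mat 2 2 (\<lambda>(i, j). if i = j then 0 else 1)"
proof -
  obtain p where p: "p permutes {..<2}"
    and P: "P = mat 2 2 (\<lambda>(i, j). if i = p j then 1 else 0)"
    using assms unfolding permutation_matrix_def by blast
  have "p 0 \<in> {..<2}" "p 1 \<in> {..<2}" "p 0 \<noteq> p 1"
    using p permutes_in_image[OF p] permutes_inj[OF p] by (auto simp: inj_eq)
  then have "p 0 = 0 \<and> p 1 = 1 \<or> p 0 = 1 \<and> p 1 = 0"
    by (auto simp: less_2_cases_iff)
  then show ?thesis
    unfolding P by (auto intro!: eq_matI simp: less_2_cases_iff)
qed

text \<open>The matrix commutes with both permutation matrices, so permuting leaves it unchanged.\<close>

lemma irreducible_matrix_symmetric_2:
  fixes m k :: real
  assumes "k \<noteq> 0"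
  shows "irreducible_matrix 2 (mat 2 2 (\<lambda>(i, j). if i = j then m else k))" (is "irreducible_matrix 2 ?A")
  unfolding irreducible_matrix_def
proof (intro conjI notI; (elim exE conjE)?)
  fix B P Q
  assume perm: "permutation_matrix 2 P" and sim: "similar_mat_wit ?A B P Q"
    and tri: "block_triangular 2 B"
  have carr: "B \<in> carrier_mat 2 2" "P \<in> carrier_mat 2 2" "Q \<in> carrier_mat 2 2"
    and QP: "Q * P = 1\<^sub>m 2" and A_eq: "?A = P * B * Q"
    using similar_mat_witD2[OF mat_carrier sim] by simp_all
  \<comment> \<open>\<open>?A\<close> is \<open>m\<close> times the identity plus \<open>k\<close>
    times the swap matrix, and \<open>P\<close> is one of these two matrices.\<close>
  have comm: "?A * P = P * ?A"
    using permutation_matrix_2_cases[OF perm]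
    by (auto intro!: eq_matI simp: less_2_cases_iff scalar_prod_def numeral_2_eq_2)
  \<comment> \<open>Inserting \<open>Q * P\<close>, which is the identity, turns
    \<open>P * B\<close> into \<open>?A * P\<close>; after commuting, multiplication by
    \<open>Q\<close> on the left cancels \<open>P\<close>.\<close>
  have "P * B = P * B * (Q * P)"
    using carr QP by simp
  also have "\<dots> = ?A * P"
    using carr unfolding A_eq by (simp add: assoc_mult_mat[of _ 2 2 _ 2 _ 2])
  finally have "P * B = P * ?A"
    by (simp only: comm)
  then have "Q * P * B = Q * P * ?A"
    using carr by (simp add: assoc_mult_mat[of _ 2 2 _ 2 _ 2])
  then have "B = ?A"
    using carr QP by simp
  with tri not_block_triangular_2[of ?A] assms show False
    by simp
qed simp

theorem mainTheorem1:
  fixes \<sigma> :: "complex list"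
  assumes "length \<sigma> = 2"
    and "list_radius \<sigma> > 0"
    and "count_list \<sigma> (complex_of_real (list_radius \<sigma>)) = 1"
  shows "irreducibly_realizable \<sigma> \<longleftrightarrow> realizable \<sigma>"
proof
  assume "realizable \<sigma>"
  then obtain A where A: "A \<in> carrier_mat 2 2" "nonneg_matrix A" "has_eigenvalue_list A \<sigma>"
    unfolding realizable_def assms(1) by blast
  define \<rho> where "\<rho> = list_radius \<sigma>"
  obtain z where z: "mset \<sigma> = {#complex_of_real \<rho>, z#}" "z \<noteq> complex_of_real \<rho>"
    using mset_eq_pair_of_count_list_eq_1[OF assms(1,3)] unfolding \<rho>_def by blast
  define t where "t = A $$ (0, 0) + A $$ (1, 1)"
  have "t \<ge> 0"
    using A(1,2) by (auto simp: t_def nonneg_matrix_def)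
  have "complex_of_real \<rho> + z = complex_of_real t"
    using A(3) has_eigenvalue_list_mat_2_iff[OF A(1) z(1)] by (simp add: t_def)
  then have z_eq: "z = complex_of_real (t - \<rho>)"
    by (simp add: algebra_simps)
  have "z \<in> set \<sigma>"
    using z(1) by (metis insert_iff set_mset_add_mset_insert set_mset_mset)
  then have "cmod z \<le> \<rho>"
    unfolding \<rho>_def list_radius_def by simp
  \<comment> \<open>Multiplicity one enters here: a real number of modulus at most \<rho> and
    different from \<rho> lies strictly below it.\<close>
  with z_eq z(2) have "t - \<rho> < \<rho>"
    by (smt (verit) norm_of_real)
  \<comment> \<open>Since \<open>z\<close> is \<open>t - \<rho>\<close>, the entry (\<rho> - z)/2
    reads \<open>\<rho> - t / 2\<close>; it is positive because t < 2 \<rho>.\<close>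
  define S where "S = mat 2 2 (\<lambda>(i, j). if i = j then t / 2 else (\<rho> - t / 2))"
  have S: "S \<in> carrier_mat 2 2"
    by (simp add: S_def)
  moreover have "nonneg_matrix S"
    using \<open>t \<ge> 0\<close> \<open>t - \<rho> < \<rho>\<close> by (auto simp: nonneg_matrix_def S_def)
  moreover have "irreducible_matrix 2 S"
    unfolding S_def using \<open>t - \<rho> < \<rho>\<close> by (intro irreducible_matrix_symmetric_2) simp
  \<comment> \<open>The trace is \<open>t\<close>, and the determinant is (t/2)^2 - (\<rho> - t/2)^2
    = \<rho> (t - \<rho>), the product of the two eigenvalues.\<close>
  moreover have "has_eigenvalue_list S \<sigma>"
    unfolding has_eigenvalue_list_mat_2_iff[OF S z(1)] z_eq of_real_mult[symmetric]
      of_real_add[symmetric] of_real_eq_iff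
    by (simp add: S_def field_simps)
  ultimately show "irreducibly_realizable \<sigma>"
    unfolding irreducibly_realizable_def assms(1) by blast
qed (auto simp: irreducibly_realizable_def realizable_def)

end
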